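(* For every connected simple graph $G$, $\mathrm{cpw}(G)\leq 2\cdot\mathrm{pw}(G)+1$.
   Context: A path decomposition of a simple graph $G$ is a sequence $(X_1,\ldots,X_d)$ of subsets of $V(G)$ such that $\bigcup_i X_i=V(G)$; every edge of $G$ has both endpoints in some $X_i$; and $X_i\cap X_k\subseteq X_j$ whenever $1\leq i\leq j\leq k\leq d$. Its width is $\max_i|X_i|-1$. The pathwidth $\mathrm{pw}(G)$ is the minimum width of a path decomposition of $G$. A path decomposition is connected if $G[X_1\cup\cdots\cup X_i]$ is connected for each $i$; the connected pathwidth $\mathrm{cpw}(G)$ is the minimum width of a connected path decomposition of $G$. *)

theory Defs
  imports "Graph_Theory.Graph_Theory"
begin

text \<open>
  A simple graph is a finite symmetric digraph without loops and parallel arcs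
  (locale \<^locale>\<open>graph\<close>): every edge is represented by its two opposite arcs.
  The predicate \<^const>\<open>connected\<close> excludes the graph without vertices.
\<close>

definition path_decomposition :: "('a, 'b) pre_digraph \<Rightarrow> 'a set list \<Rightarrow> bool" where
  "path_decomposition G Xs \<longleftrightarrow>
     Xs \<noteq> [] \<and>
     \<Union>(set Xs) = verts G \<and>
     (\<forall>e\<in>arcs G. \<exists>X\<in>set Xs. tail G e \<in> X \<and> head G e \<in> X) \<and>
     (\<forall>i j k. i \<le> j \<and> j \<le> k \<and> k < length Xs \<longrightarrow> Xs ! i \<inter> Xs ! k \<subseteq> Xs ! j)"

definition connected_path_decomposition :: "('a, 'b) pre_digraph \<Rightarrow> 'a set list \<Rightarrow> bool" where
  "connected_path_decomposition G Xs \<longleftrightarrow>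
     path_decomposition G Xs \<and>
     (\<forall>i\<in>{1..length Xs}. connected (G \<restriction> \<Union>(set (take i Xs))))"

text \<open>
  Widths are integers, so that the subtraction of one is not truncated if all bags are empty.
\<close>

definition width :: "'a set list \<Rightarrow> int" where
  "width Xs = int (Max (card ` set Xs)) - 1"

definition pathwidth :: "('a, 'b) pre_digraph \<Rightarrow> int" where
  "pathwidth G = Min {width Xs | Xs. path_decomposition G Xs}"

definition connected_pathwidth :: "('a, 'b) pre_digraph \<Rightarrow> int" where
  "connected_pathwidth G = Min {width Xs | Xs. connected_path_decomposition G Xs}"

text \<open>
  \<^const>\<open>Min\<close> is only meaningful on finite nonempty sets; the following facts show that both
  minima are taken over such sets.
\<close>

lemma finite_path_decomposition_widths:
  assumes "finite (verts G)"
  shows "finite {width Xs | Xs. path_decomposition G Xs}"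
proof -
  have "width Xs \<in> {-1..int (card (verts G))}" if pd: "path_decomposition G Xs" for Xs
  proof -
    let ?C = "card ` set Xs"
    have "?C \<noteq> {}" "finite ?C" using pd by (auto simp: path_decomposition_def)
    then have "Max ?C \<in> ?C" by simp
    then obtain X where X: "X \<in> set Xs" "Max ?C = card X" by auto
    have "X \<subseteq> verts G" using X(1) pd by (auto simp: path_decomposition_def)
    then have "card X \<le> card (verts G)" using assms by (rule card_mono[rotated])
    then show ?thesis using X(2) by (simp add: width_def)
  qed
  then have "{width Xs | Xs. path_decomposition G Xs} \<subseteq> {-1..int (card (verts G))}"
    by blast
  then show ?thesis by (rule finite_subset) simp
qed

lemma finite_connected_path_decomposition_widths:
  assumes "finite (verts G)"
  shows "finite {width Xs | Xs. connected_path_decomposition G Xs}"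
  by (rule finite_subset[OF _ finite_path_decomposition_widths[OF assms]])
     (auto simp: connected_path_decomposition_def)

lemma (in wf_digraph) path_decomposition_trivial: "path_decomposition G [verts G]"
  by (auto simp: path_decomposition_def)

lemma (in wf_digraph) connected_path_decomposition_trivial:
  assumes "connected G"
  shows "connected_path_decomposition G [verts G]"
proof -
  have "{e \<in> arcs G. tail G e \<in> verts G \<and> head G e \<in> verts G} = arcs G"
    by auto
  then have "G \<restriction> verts G = G"
    by (simp add: induce_subgraph_def)
  then show ?thesis
    using assms path_decomposition_trivial
    by (simp add: connected_path_decomposition_def)
qed

end

theory Submission
  imports Defs
begin

text \<open>
  Enumerate the vertices by the first bag in which they occur. A path decomposition of width \<open>w\<close>
  then guarantees that at most \<open>w\<close> vertices before any gap of the enumeration have neighbours behind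
  it. The star of a vertex consists of the vertex and its later neighbours; replacing each star by a
  path through its members in increasing order gives a multigraph on the same vertices in which every
  gap is crossed by at most \<open>w\<close> edges.

  Now add the vertices one by one to a set \<open>E\<close>, always choosing the median of the outer endpoints of
  the edges leaving \<open>E\<close>. The invariant is that at each gap one of the two sides of \<open>E\<close> has
  at most as many leaving edges staying on that side as it has edges crossing the gap. At the
  median both sides satisfy this, so the edges leaving the enlarged set can be charged injectively to
  the edges crossing the two gaps next to the new vertex, and there are at most \<open>2w\<close> of them.

  The bags of the connected path decomposition are the centres of the stars that meet \<open>E\<close> after the
  addition of a vertex and were not contained in \<open>E\<close> before. The new vertex shares a star with
  the old set, so the vertices whose stars meet \<open>E\<close> always induce a connected subgraph.
\<close>

section \<open>Balanced sets in a linearly ordered multigraph\<close>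

lemma card_split: "finite A \<Longrightarrow> card A = card {e \<in> A. P e} + card {e \<in> A. \<not> P e}"
  by (subst card_Un_disjoint[symmetric]) (auto intro!: arg_cong[where f = card])

text \<open>Edges are abstract objects with endpoint maps, so that parallel edges stay distinct. The
  gap \<open>g\<close> lies just before position \<open>g\<close>.\<close>

locale linear_multigraph =
  fixes F :: "'e set" and lo hi :: "'e \<Rightarrow> nat" and w :: nat
  assumes finite_F: "finite F"
    and lo_less_hi: "e \<in> F \<Longrightarrow> lo e < hi e"
    and card_gap_le: "card {e \<in> F. lo e < g \<and> g \<le> hi e} \<le> w"
begin

definition cut :: "nat set \<Rightarrow> 'e set" where
  "cut E = {e \<in> F. (lo e \<in> E) \<noteq> (hi e \<in> E)}"

text \<open>Whether \<open>E\<close> is fine on the left of the gap before \<open>g\<close> depends only on the part of \<open>E\<close>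
  below \<open>g\<close>, and dually. Hence adding \<open>x\<close> preserves the left condition for \<open>g \<le> x\<close> and the
  right condition for \<open>g > x\<close>.\<close>

definition left_ok :: "nat set \<Rightarrow> nat \<Rightarrow> bool" where
  "left_ok E g \<longleftrightarrow> card {e \<in> cut E. hi e < g} \<le> card {e \<in> F. lo e < g \<and> g \<le> hi e \<and> lo e \<in> E}"

definition right_ok :: "nat set \<Rightarrow> nat \<Rightarrow> bool" where
  "right_ok E g \<longleftrightarrow> card {e \<in> cut E. g \<le> lo e} \<le> card {e \<in> F. lo e < g \<and> g \<le> hi e \<and> hi e \<in> E}"

definition balanced :: "nat set \<Rightarrow> bool" where
  "balanced E \<longleftrightarrow> (\<forall>g. left_ok E g \<or> right_ok E g)"

lemma finite_cut [simp]: "finite (cut E)"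
  using finite_F by (simp add: cut_def)

text \<open>Meaningful on \<open>cut E\<close> only, where it is the endpoint outside
  \<open>E\<close>.\<close>

definition target :: "nat set \<Rightarrow> 'e \<Rightarrow> nat" where
  "target E e = (if lo e \<in> E then hi e else lo e)"

lemma card_targets_less:
  "card {e \<in> cut E. target E e < g} =
     card {e \<in> cut E. hi e < g} + card {e \<in> cut E. lo e < g \<and> g \<le> hi e \<and> hi e \<in> E}"
proof -
  have 1: "{e \<in> cut E. target E e < g} =
      {e \<in> cut E. hi e < g} \<union> {e \<in> cut E. lo e < g \<and> g \<le> hi e \<and> hi e \<in> E}"
    by (auto simp: cut_def target_def dest: lo_less_hi)
  show ?thesis unfolding 1 by (rule card_Un_disjoint) auto
qed

lemma card_targets_ge:
  "card {e \<in> cut E. g \<le> target E e} =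
     card {e \<in> cut E. g \<le> lo e} + card {e \<in> cut E. lo e < g \<and> g \<le> hi e \<and> lo e \<in> E}"
proof -
  have 1: "{e \<in> cut E. g \<le> target E e} =
      {e \<in> cut E. g \<le> lo e} \<union> {e \<in> cut E. lo e < g \<and> g \<le> hi e \<and> lo e \<in> E}"
    by (auto simp: cut_def target_def dest: lo_less_hi)
  show ?thesis unfolding 1 by (rule card_Un_disjoint) auto
qed

text \<open>Crossing edges with both ends in \<open>E\<close> count for both sides, so the
  right-hand sides of \<open>left_ok\<close> and \<open>right_ok\<close> differ only in cut
  edges.\<close>

lemma card_crossing:
  "card {e \<in> F. lo e < g \<and> g \<le> hi e \<and> lo e \<in> E} =
     card {e \<in> F. lo e < g \<and> g \<le> hi e \<and> lo e \<in> E \<and> hi e \<in> E} +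
     card {e \<in> cut E. lo e < g \<and> g \<le> hi e \<and> lo e \<in> E}" (is "card ?A = card ?B + card ?C")
  "card {e \<in> F. lo e < g \<and> g \<le> hi e \<and> hi e \<in> E} =
     card {e \<in> F. lo e < g \<and> g \<le> hi e \<and> lo e \<in> E \<and> hi e \<in> E} +
     card {e \<in> cut E. lo e < g \<and> g \<le> hi e \<and> hi e \<in> E}" (is "card ?A' = card ?B + card ?C'")
proof -
  have "?A = ?B \<union> ?C" "?A' = ?B \<union> ?C'" "?B \<inter> ?C = {}" "?B \<inter> ?C' = {}"
    by (auto simp: cut_def)
  then show "card ?A = card ?B + card ?C" "card ?A' = card ?B + card ?C'"
    using finite_F by (simp_all add: card_Un_disjoint)
qed

text \<open>Let \<open>a\<close>, \<open>b\<close> count the cut edges wholly left and right of the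
  gap, \<open>c\<close>, \<open>d\<close> the crossing cut edges with \<open>lo\<close> and
  \<open>hi\<close> in \<open>E\<close>, and \<open>k\<close> the crossing edges inside
  \<open>E\<close>. Then \<open>b \<le> k + d\<close> and \<open>a + d \<le> b + c\<close> give
  \<open>a \<le> k + c\<close>.\<close>

lemma left_ok_of_right_ok:
  assumes "right_ok E g" "card {e \<in> cut E. target E e < g} \<le> card {e \<in> cut E. g \<le> target E e}"
  shows "left_ok E g"
  using assms card_crossing[of g E] card_targets_less[of E g] card_targets_ge[of E g]
  unfolding left_ok_def right_ok_def by linarith

lemma right_ok_of_left_ok:
  assumes "left_ok E g" "card {e \<in> cut E. g \<le> target E e} \<le> card {e \<in> cut E. target E e < g}"
  shows "right_ok E g"
  using assms card_crossing[of g E] card_targets_less[of E g] card_targets_ge[of E g]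
  unfolding left_ok_def right_ok_def by linarith

text \<open>Order the cut edges by their endpoint outside \<open>E\<close>. At every gap below the median target
  at most half of the targets lie to the left, so that the right condition implies the left one;
  above the median it is the other way round.\<close>

lemma median_target:
  assumes "balanced E" "cut E \<noteq> {}"
  obtains e where "e \<in> cut E" "\<And>g. g \<le> target E e \<Longrightarrow> left_ok E g"
    "\<And>g. target E e < g \<Longrightarrow> right_ok E g"
proof -
  define L where "L g = {e \<in> cut E. target E e < g}" for g
  define R where "R g = {e \<in> cut E. g \<le> target E e}" for g
  have LR: "card (L g) + card (R g) = card (cut E)" for g
    using card_split[of "cut E" "\<lambda>e. target E e < g"] by (simp add: L_def R_def not_less)
  have L_mono: "card (L g) \<le> card (L h)" if "g \<le> h" for g h
    using that by (intro card_mono) (auto simp: L_def)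
  have R_antimono: "card (R h) \<le> card (R g)" if "g \<le> h" for g h
    using that by (intro card_mono) (auto simp: R_def)
  \<comment> \<open>The least such \<open>x\<close> is the lower median: at least half of the
    targets are at or before it.\<close>
  define P where "P x \<longleftrightarrow> card (R (Suc x)) \<le> card (L (Suc x))" for x
  have "R (Suc (Max (target E ` cut E))) = {}"
    by (auto simp: R_def not_le less_Suc_eq_le)
  then have ex: "P (Max (target E ` cut E))" by (simp add: P_def)
  define x where "x = (LEAST x. P x)"
  have Px: "P x" unfolding x_def using ex by (rule LeastI)
  have Lx: "card (L x) < card (R x) \<or> x = 0"
  proof (cases x)
    case (Suc y)
    then have "\<not> P y" unfolding x_def by (metis lessI not_less_Least)
    then show ?thesis using Suc by (simp add: P_def)
  qed simp
  \<comment> \<open>Without a target at \<open>x\<close> the counts at \<open>x\<close> and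
    \<open>Suc x\<close> agree. This contradicts \<open>Lx\<close> unless \<open>x = 0\<close>, and
    then there are no targets at all.\<close>
  have "\<exists>e \<in> cut E. target E e = x"
  proof (rule ccontr)
    assume "\<not> ?thesis"
    then have "L (Suc x) = L x" "R (Suc x) = R x"
      by (auto simp: L_def R_def less_Suc_eq Suc_le_eq order_less_le)
    then have "card (R x) \<le> card (L x)" using Px by (simp add: P_def)
    then have x0: "x = 0" using Lx by simp
    then have "card (L x) = 0" by (simp add: L_def)
    then have "card (cut E) = 0" using \<open>card (R x) \<le> card (L x)\<close> LR[of x] by simp
    then show False using assms(2) by simp
  qed
  then obtain e where e: "e \<in> cut E" "target E e = x" by blast
  show ?thesis
  proof (rule that[OF e(1)])
    fix g assume "g \<le> target E e"
    then have "card (L g) \<le> card (R g)"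
      using L_mono[of g x] R_antimono[of g x] Lx e(2) by (cases "x = 0") (auto simp: L_def)
    then show "left_ok E g"
      using assms(1) left_ok_of_right_ok[of E g] unfolding balanced_def L_def R_def by blast
  next
    fix g assume "target E e < g"
    then have "card (R g) \<le> card (L g)"
      using L_mono[of "Suc x" g] R_antimono[of "Suc x" g] Px e(2) unfolding P_def by simp
    then show "right_ok E g"
      using assms(1) right_ok_of_left_ok[of E g] unfolding balanced_def L_def R_def by blast
  qed
qed

section \<open>Inserting the median target\<close>

context
  fixes E :: "nat set" and x :: nat
  assumes fresh: "x \<notin> E"
    and left: "\<And>g. g \<le> x \<Longrightarrow> left_ok E g"
    and right: "\<And>g. x < g \<Longrightarrow> right_ok E g"
begin

lemma balanced_insert: "balanced (insert x E)"
  unfolding balanced_def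
proof
  fix g
  show "left_ok (insert x E) g \<or> right_ok (insert x E) g"
  proof (cases "g \<le> x")
    case True
    have "{e \<in> cut (insert x E). hi e < g} = {e \<in> cut E. hi e < g}"
      "{e \<in> F. lo e < g \<and> g \<le> hi e \<and> lo e \<in> insert x E} = {e \<in> F. lo e < g \<and> g \<le> hi e \<and> lo e \<in> E}"
      using True by (auto simp: cut_def dest: lo_less_hi)
    then show ?thesis using left[OF True] by (simp add: left_ok_def)
  next
    case False
    have "{e \<in> cut (insert x E). g \<le> lo e} = {e \<in> cut E. g \<le> lo e}"
      "{e \<in> F. lo e < g \<and> g \<le> hi e \<and> hi e \<in> insert x E} = {e \<in> F. lo e < g \<and> g \<le> hi e \<and> hi e \<in> E}"
      using False by (auto simp: cut_def dest: lo_less_hi)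
    then show ?thesis using right[of g] False by (simp add: right_ok_def)
  qed
qed

text \<open>Of the edges crossing the gap before \<open>x\<close>, those with \<open>lo\<close> in
  \<open>E\<close> pay, by \<open>left_ok\<close>, for the cut edges wholly left of
  \<open>x\<close>; those with \<open>lo\<close> outside \<open>E\<close> pay for themselves. The
  gap after \<open>x\<close> serves the right side likewise.\<close>

lemma card_cut_insert:
  "card (cut (insert x E)) \<le>
     card {e \<in> F. lo e < x \<and> x \<le> hi e} + card {e \<in> F. lo e < Suc x \<and> Suc x \<le> hi e}"
proof -
  let ?A = "{e \<in> F. lo e < x \<and> x \<le> hi e}" and ?B = "{e \<in> F. lo e < Suc x \<and> Suc x \<le> hi e}"
  let ?S1 = "{e \<in> cut E. hi e < x}" and ?S2 = "{e \<in> cut E. Suc x \<le> lo e}"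
  let ?S3 = "{e \<in> ?A. \<not> lo e \<in> E}" and ?S4 = "{e \<in> ?B. \<not> hi e \<in> E}"
  have "cut (insert x E) \<subseteq> (?S1 \<union> ?S2) \<union> (?S3 \<union> ?S4)"
    using lo_less_hi by (force simp: cut_def)
  then have "card (cut (insert x E)) \<le> card ((?S1 \<union> ?S2) \<union> (?S3 \<union> ?S4))"
    using finite_F by (intro card_mono) auto
  also have "\<dots> \<le> (card ?S1 + card ?S2) + (card ?S3 + card ?S4)"
    by (intro order_trans[OF card_Un_le] add_mono card_Un_le)
  finally have le: "card (cut (insert x E)) \<le> card ?S1 + card ?S2 + card ?S3 + card ?S4" by simp
  have "card ?S1 \<le> card {e \<in> ?A. lo e \<in> E}"
    using left[of x] by (simp add: left_ok_def conj_ac)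
  moreover have "card ?S2 \<le> card {e \<in> ?B. hi e \<in> E}"
    using right[of "Suc x"] by (simp add: right_ok_def conj_ac)
  moreover have "card ?A = card {e \<in> ?A. lo e \<in> E} + card ?S3"
    using finite_F by (intro card_split) simp
  moreover have "card ?B = card {e \<in> ?B. hi e \<in> E} + card ?S4"
    using finite_F by (intro card_split) simp
  ultimately show ?thesis using le by linarith
qed

lemma card_cut_insert_le: "card (cut (insert x E)) \<le> 2 * w"
  using card_cut_insert card_gap_le[of x] card_gap_le[of "Suc x"] by linarith

text \<open>Averaging the bounds on the cuts before and after the insertion of \<open>x\<close>: an edge at \<open>x\<close>
  lies in exactly one of the two cuts, all others lie in both or in none.\<close>

lemma card_cut_away_le:
  assumes "card (cut E) \<le> 2 * w"
  shows "card {e \<in> cut E. lo e \<noteq> x \<and> hi e \<noteq> x} + card {e \<in> F. hi e = x} \<le> 2 * w"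
proof -
  let ?N = "{e \<in> cut E. lo e \<noteq> x \<and> hi e \<noteq> x}"
  let ?T = "{e \<in> F. hi e = x}" and ?U = "{e \<in> F. lo e = x}"
  let ?A = "{e \<in> F. lo e < x \<and> x \<le> hi e}" and ?B = "{e \<in> F. lo e < Suc x \<and> Suc x \<le> hi e}"
  have "cut E = ?N \<union> ({e \<in> ?T. lo e \<in> E} \<union> {e \<in> ?U. hi e \<in> E})"
    using fresh by (auto simp: cut_def)
  moreover have "card (?N \<union> ({e \<in> ?T. lo e \<in> E} \<union> {e \<in> ?U. hi e \<in> E})) =
      card ?N + (card {e \<in> ?T. lo e \<in> E} + card {e \<in> ?U. hi e \<in> E})"
    using finite_F by (subst card_Un_disjoint | force dest: lo_less_hi)+
  moreover have "cut (insert x E) = ?N \<union> ({e \<in> ?T. lo e \<notin> E} \<union> {e \<in> ?U. hi e \<notin> E})"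
    using fresh by (auto simp: cut_def dest: lo_less_hi)
  moreover have "card (?N \<union> ({e \<in> ?T. lo e \<notin> E} \<union> {e \<in> ?U. hi e \<notin> E})) =
      card ?N + (card {e \<in> ?T. lo e \<notin> E} + card {e \<in> ?U. hi e \<notin> E})"
    using finite_F by (subst card_Un_disjoint | force dest: lo_less_hi)+
  moreover have "card ?T = card {e \<in> ?T. lo e \<in> E} + card {e \<in> ?T. lo e \<notin> E}"
    "card ?U = card {e \<in> ?U. hi e \<in> E} + card {e \<in> ?U. hi e \<notin> E}"
    using finite_F by (intro card_split; simp)+
  \<comment> \<open>Both sides are the edges with \<open>lo e \<le> x\<close> and
    \<open>x \<le> hi e\<close>. Eliminating \<open>card ?B\<close> from the sum of the two cut
    bounds leaves \<open>2 * (card ?N + card ?T) \<le> 2 * w + 2 * card ?A\<close>.\<close>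
  moreover have "?A \<union> ?U = ?B \<union> ?T" by (auto dest: lo_less_hi)
  moreover have "card (?A \<union> ?U) = card ?A + card ?U" "card (?B \<union> ?T) = card ?B + card ?T"
    using finite_F by (auto intro!: card_Un_disjoint)
  ultimately show ?thesis using assms card_cut_insert card_gap_le[of x] by simp
qed

end

end

section \<open>Vertex layouts\<close>

text \<open>A certificate of connectedness that is easy to extend and to map along the enumeration
  of the vertices.\<close>

inductive grown :: "('a \<Rightarrow> 'a \<Rightarrow> bool) \<Rightarrow> 'a set \<Rightarrow> bool" for r where
  singleton: "grown r {x}"
| insert: "grown r S \<Longrightarrow> s \<in> S \<Longrightarrow> r s x \<Longrightarrow> grown r (insert x S)"

lemma grown_Un:
  assumes "finite T" "grown r S" "\<And>t. t \<in> T \<Longrightarrow> t \<in> S \<or> (\<exists>s \<in> S. r s t)"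
  shows "grown r (S \<union> T)"
  using assms(1,3)
proof (induction T)
  case empty
  then show ?case using assms(2) by simp
next
  case (insert t T)
  then have IH: "grown r (S \<union> T)" by blast
  show ?case
  proof (cases "t \<in> S")
    case True
    then show ?thesis using IH by (simp add: insert_absorb)
  next
    case False
    then obtain s where "s \<in> S" "r s t" using insert.prems by blast
    then show ?thesis using IH grown.insert[of r "S \<union> T" s t] by simp
  qed
qed

text \<open>Vertices are positions below \<open>n\<close>. \<open>card_separator_le\<close> bounds
  the vertex separation of the layout by \<open>w\<close>.\<close>

locale vertex_layout =
  fixes n :: nat and adj :: "nat \<Rightarrow> nat \<Rightarrow> bool" and w :: nat
  assumes adj_sym: "adj i j \<Longrightarrow> adj j i"
    and adj_irrefl: "\<not> adj i i"
    and adj_less: "adj i j \<Longrightarrow> i < n"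
    and card_separator_le: "card {i. i < g \<and> (\<exists>j\<ge>g. adj i j)} \<le> w"
    and adj_connected: "S \<subset> {..<n} \<Longrightarrow> S \<noteq> {} \<Longrightarrow> \<exists>i\<in>S. \<exists>j\<in>{..<n} - S. adj i j"
begin

section \<open>Stars and the multigraph of their paths\<close>

definition star :: "nat \<Rightarrow> nat set" where
  "star u = insert u {z. u < z \<and> adj u z}"

text \<open>The star of \<open>u\<close> is cut into a path through its members in increasing order:
  \<open>(u, z)\<close> stands for the edge from the member preceding \<open>z\<close> to \<open>z\<close>.\<close>

definition path_edges :: "(nat \<times> nat) set" where
  "path_edges = {(u, z). u < z \<and> adj u z}"

definition lo :: "nat \<times> nat \<Rightarrow> nat" where
  "lo e = Max {y \<in> star (fst e). y < snd e}"

lemma adj_less': "adj i j \<Longrightarrow> j < n"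
  using adj_sym adj_less by blast

lemma finite_star [simp]: "finite (star u)"
proof -
  have "{z. u < z \<and> adj u z} \<subseteq> {..<n}" using adj_less' by auto
  then show ?thesis by (auto simp: star_def intro: finite_subset)
qed

lemma finite_path_edges: "finite path_edges"
proof -
  have "path_edges \<subseteq> {..<n} \<times> {..<n}"
    using adj_less adj_less' by (auto simp: path_edges_def)
  then show ?thesis by (rule finite_subset) simp
qed

lemma lo_props:
  assumes "(u, z) \<in> path_edges"
  shows "lo (u, z) \<in> star u" "lo (u, z) < z" "u \<le> lo (u, z)"
    "\<And>y. y \<in> star u \<Longrightarrow> y < z \<Longrightarrow> y \<le> lo (u, z)"
proof -
  have fin: "finite {y \<in> star u. y < z}" by simp
  have u: "u \<in> {y \<in> star u. y < z}" using assms by (auto simp: path_edges_def star_def)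
  have "lo (u, z) \<in> {y \<in> star u. y < z}"
    unfolding lo_def fst_conv snd_conv using u by (intro Max_in[OF fin]) blast
  then show "lo (u, z) \<in> star u" "lo (u, z) < z" by auto
  show "u \<le> lo (u, z)" using Max_ge[OF fin u] by (simp add: lo_def)
  show "y \<le> lo (u, z)" if "y \<in> star u" "y < z" for y
    using Max_ge[OF fin, of y] that by (simp add: lo_def)
qed

text \<open>An increasing path crosses a gap at most once, and the centre of a star whose path
  crosses it is a vertex before the gap with a neighbour behind it.\<close>

lemma gap_le:
  "card {e \<in> path_edges. lo e < g \<and> g \<le> snd e} \<le> w" (is "card ?C \<le> w")
proof -
  have "inj_on fst ?C"
  proof (rule inj_onI)
    fix e e' assume e: "e \<in> ?C" "e' \<in> ?C" "fst e = fst e'"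
    obtain u z z' where [simp]: "e = (u, z)" "e' = (u, z')"
      using e(3) by (metis prod.collapse)
    have "z \<in> star u" "z' \<in> star u" using e(1,2) by (auto simp: path_edges_def star_def)
    \<comment> \<open>If \<open>z < z'\<close>, then \<open>z \<le> lo (u, z')\<close>, which is
      below \<open>g\<close>, although \<open>g \<le> z\<close>.\<close>
    then have "\<not> z < z'" "\<not> z' < z"
      using e(1,2) lo_props(4)[of u z z'] lo_props(4)[of u z' z] by fastforce+
    then show "e = e'" by simp
  qed
  then have "card ?C = card (fst ` ?C)" by (simp add: card_image)
  also have "\<dots> \<le> card {i. i < g \<and> (\<exists>j\<ge>g. adj i j)}"
  proof (rule card_mono)
    show "fst ` ?C \<subseteq> {i. i < g \<and> (\<exists>j\<ge>g. adj i j)}"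
      using lo_props(3) by (fastforce simp: path_edges_def)
  qed simp
  also have "\<dots> \<le> w" by (rule card_separator_le)
  finally show ?thesis .
qed

sublocale linear_multigraph path_edges lo snd w
  using finite_path_edges lo_props(2) gap_le by unfold_locales auto

text \<open>The path connects the star: if none of its edges is cut, membership in \<open>E\<close>
  propagates from \<open>u\<close> to all members.\<close>

lemma star_cut:
  assumes "a \<in> star u" "a \<in> E" "b \<in> star u" "b \<notin> E"
  obtains e where "e \<in> cut E" "fst e = u"
proof -
  have "\<exists>e. e \<in> cut E \<and> fst e = u"
  proof (rule ccontr)
    assume no: "\<not> ?thesis"
    have "z \<in> star u \<Longrightarrow> z \<in> E \<longleftrightarrow> u \<in> E" for z
    proof (induction z rule: less_induct)
      case (less z)
      show ?case
      proof (cases "z = u")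
        case False
        then have e: "(u, z) \<in> path_edges" using less.prems by (auto simp: star_def path_edges_def)
        then have "lo (u, z) \<in> E \<longleftrightarrow> z \<in> E" using no by (fastforce simp: cut_def)
        then show ?thesis using less.IH lo_props(1,2)[OF e] by blast
      qed simp
    qed
    then show False using assms by blast
  qed
  then show ?thesis using that by blast
qed

lemma path_edge_in_star:
  assumes "e \<in> path_edges"
  shows "lo e \<in> star (fst e)" "snd e \<in> star (fst e)" "fst e < n"
  using assms lo_props(1) adj_less by (cases e; auto simp: path_edges_def star_def)+

lemma cut_nonempty:
  assumes "E \<subset> {..<n}" "E \<noteq> {}"
  shows "cut E \<noteq> {}"
proof -
  obtain i j where ij: "i \<in> E" "j \<notin> E" "adj i j" using adj_connected[OF assms] by blast
  then have "i < j \<or> j < i" using adj_irrefl by (metis nat_neq_iff)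
  then have "(i \<in> star (min i j)) \<and> j \<in> star (min i j)"
    using ij(3) adj_sym by (auto simp: star_def min_def)
  then show ?thesis using star_cut[of i "min i j" E j] ij by auto
qed

section \<open>Bags and the order of insertion\<close>

definition bag :: "nat set \<Rightarrow> nat \<Rightarrow> nat set" where
  "bag E x = {u. u < n \<and> star u \<inter> insert x E \<noteq> {} \<and> \<not> star u \<subseteq> E}"

text \<open>Each centre \<open>u\<close> other than \<open>x\<close> is charged to an edge of its
  own path: to \<open>(u, x)\<close> if \<open>x\<close> is in its star, otherwise to a cut edge,
  which then avoids \<open>x\<close>. The extra one is \<open>x\<close> itself.\<close>

lemma card_bag_le:
  assumes "x \<notin> E" "\<And>g. g \<le> x \<Longrightarrow> left_ok E g" "\<And>g. x < g \<Longrightarrow> right_ok E g" "card (cut E) \<le> 2 * w"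
  shows "card (bag E x) \<le> 2 * w + 1"
proof -
  let ?N = "{e \<in> cut E. lo e \<noteq> x \<and> snd e \<noteq> x}" and ?T = "{e \<in> path_edges. snd e = x}"
  have fin: "finite ?N" "finite ?T" using finite_path_edges by simp_all
  have "bag E x \<subseteq> insert x (fst ` (?N \<union> ?T))"
  proof
    fix u assume u: "u \<in> bag E x"
    show "u \<in> insert x (fst ` (?N \<union> ?T))"
    proof (cases "x \<in> star u")
      case True
      then have "u = x \<or> (u, x) \<in> ?T" by (auto simp: star_def path_edges_def)
      then show ?thesis by force
    next
      case False
      then obtain e where e: "e \<in> cut E" "fst e = u"
        using u star_cut[of _ u E] unfolding bag_def by blast
      then have "lo e \<noteq> x" "snd e \<noteq> x"
        using False path_edge_in_star[of e] by (auto simp: cut_def)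
      then show ?thesis using e by blast
    qed
  qed
  then have "card (bag E x) \<le> card (insert x (fst ` (?N \<union> ?T)))"
    using fin by (intro card_mono) auto
  also have "\<dots> \<le> Suc (card (?N \<union> ?T))"
    using fin card_image_le[of "?N \<union> ?T" fst] by (simp add: card_insert_if)
  also have "\<dots> \<le> Suc (card ?N + card ?T)" using card_Un_le by simp
  finally show ?thesis using card_cut_away_le[OF assms] by simp
qed

definition good_order :: "nat list \<Rightarrow> bool" where
  "good_order xs \<longleftrightarrow> distinct xs \<and> set xs \<subseteq> {..<n} \<and>
     (\<forall>j < length xs. card (bag (set (take j xs)) (xs ! j)) \<le> 2 * w + 1) \<and>
     (\<forall>j < length xs. 0 < j \<longrightarrow> (\<exists>u. xs ! j \<in> star u \<and> star u \<inter> set (take j xs) \<noteq> {}))"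

lemma good_order_snoc:
  assumes "good_order xs" "x < n" "x \<notin> set xs" "card (bag (set xs) x) \<le> 2 * w + 1"
    "xs \<noteq> [] \<Longrightarrow> \<exists>u. x \<in> star u \<and> star u \<inter> set xs \<noteq> {}"
  shows "good_order (xs @ [x])"
  using assms unfolding good_order_def by (auto simp: nth_append less_Suc_eq)

text \<open>Balance yields the next vertex through \<open>median_target\<close>; the cut bound is
  what \<open>card_bag_le\<close> needs for its bag.\<close>

lemma ex_good_prefix:
  "m \<le> n \<Longrightarrow> \<exists>xs. length xs = m \<and> good_order xs \<and> balanced (set xs) \<and> card (cut (set xs)) \<le> 2 * w"
proof (induction m)
  case 0
  have "cut {} = {}" by (simp add: cut_def)
  then show ?case
    by (simp add: good_order_def balanced_def left_ok_def)
next
  case (Suc m)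
  then obtain xs where xs: "length xs = m" "good_order xs" "balanced (set xs)"
    "card (cut (set xs)) \<le> 2 * w" by auto
  have d: "distinct xs" "set xs \<subseteq> {..<n}" using xs(2) by (auto simp: good_order_def)
  have "\<exists>x < n. x \<notin> set xs \<and> (\<forall>g \<le> x. left_ok (set xs) g) \<and> (\<forall>g > x. right_ok (set xs) g) \<and>
      (xs \<noteq> [] \<longrightarrow> (\<exists>u. x \<in> star u \<and> star u \<inter> set xs \<noteq> {}))"
  proof (cases "xs = []")
    case True
    have "left_ok {} g" "right_ok {} g" for g by (simp_all add: left_ok_def right_ok_def cut_def)
    then show ?thesis using True Suc.prems by (intro exI[of _ 0]) auto
  next
    case False
    have "set xs \<noteq> {..<n}"
      using d(1) xs(1) Suc.prems by (metis card_lessThan distinct_card Suc_n_not_le_n)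
    then have "cut (set xs) \<noteq> {}" using d(2) False by (intro cut_nonempty) auto
    then obtain e where e: "e \<in> cut (set xs)"
      "\<And>g. g \<le> target (set xs) e \<Longrightarrow> left_ok (set xs) g"
      "\<And>g. target (set xs) e < g \<Longrightarrow> right_ok (set xs) g"
      using median_target[OF xs(3)] by blast
    have "e \<in> path_edges" using e(1) by (simp add: cut_def)
    note s = path_edge_in_star[OF this]
    have t: "target (set xs) e \<in> star (fst e)" "target (set xs) e \<notin> set xs"
      "star (fst e) \<inter> set xs \<noteq> {}"
      using e(1) s by (auto simp: target_def cut_def)
    have "target (set xs) e < n"
      using t(1) s(3) adj_less' by (auto simp: star_def)
    then show ?thesis using e(2,3) t by blast
  qed
  then obtain x where x: "x < n" "x \<notin> set xs" "\<And>g. g \<le> x \<Longrightarrow> left_ok (set xs) g"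
    "\<And>g. x < g \<Longrightarrow> right_ok (set xs) g"
    "xs \<noteq> [] \<Longrightarrow> \<exists>u. x \<in> star u \<and> star u \<inter> set xs \<noteq> {}" by blast
  have "good_order (xs @ [x])"
    using good_order_snoc[OF xs(2) x(1,2) card_bag_le[OF x(2-4) xs(4)] x(5)] .
  moreover have "balanced (set (xs @ [x]))" using balanced_insert[OF x(2-4)] by simp
  moreover have "card (cut (set (xs @ [x]))) \<le> 2 * w" using card_cut_insert_le[OF x(2-4)] by simp
  ultimately show ?case using xs(1) by (intro exI[of _ "xs @ [x]"]) simp
qed

lemma ex_bags:
  obtains B where "\<And>j. j < n \<Longrightarrow> card (B j) \<le> 2 * w + 1"
    "(\<Union>j<n. B j) = {..<n}"
    "\<And>u z. adj u z \<Longrightarrow> \<exists>j<n. u \<in> B j \<and> z \<in> B j"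
    "\<And>i j k. i \<le> j \<Longrightarrow> j \<le> k \<Longrightarrow> k < n \<Longrightarrow> B i \<inter> B k \<subseteq> B j"
    "\<And>i. 0 < i \<Longrightarrow> i \<le> n \<Longrightarrow> grown adj (\<Union>j<i. B j)"
proof -
  obtain xs where xs: "length xs = n" "good_order xs" using ex_good_prefix[of n] by blast
  have d: "distinct xs" "set xs \<subseteq> {..<n}" using xs(2) by (auto simp: good_order_def)
  have set_xs: "set xs = {..<n}"
    using d xs(1) by (intro card_subset_eq) (auto simp: distinct_card)
  define E where "E j = set (take j xs)" for j
  define B where "B j = bag (E j) (xs ! j)" for j
  have E_Suc: "E (Suc j) = insert (xs ! j) (E j)" if "j < n" for j
    using that xs(1) by (simp add: E_def take_Suc_conv_app_nth)
  have E_mono: "E i \<subseteq> E j" if "i \<le> j" for i j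
    using that by (simp add: E_def set_take_subset_set_take)
  have E_iff: "z \<in> E i \<longleftrightarrow> (\<exists>j<i. j < n \<and> xs ! j = z)" for z i
    using xs(1) by (auto simp: E_def in_set_conv_nth)
  have fresh: "xs ! j \<notin> E j" if "j < n" for j
    using that d(1) xs(1) by (auto simp: E_iff nth_eq_iff_index_eq)
  have xs_less: "xs ! j < n" if "j < n" for j
    using that set_xs xs(1) by (metis lessThan_iff nth_mem)
  have pos: "\<exists>j<n. xs ! j = z" if "z < n" for z
    using that set_xs xs(1) by (metis in_set_conv_nth lessThan_iff)
  have B_iff: "u \<in> B j \<longleftrightarrow> u < n \<and> star u \<inter> E (Suc j) \<noteq> {} \<and> \<not> star u \<subseteq> E j" if "j < n" for u j
    using E_Suc[OF that] by (simp add: B_def bag_def)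
  \<comment> \<open>Containment is tested against the old set, so a centre whose star is completed
    by \<open>xs ! j\<close> still belongs to \<open>B j\<close>.\<close>
  have in_B: "u \<in> B j" if "u < n" "j < n" "xs ! j \<in> star u" for u j
    using that fresh E_Suc by (auto simp: B_def bag_def)
  have touched: "(\<Union>j<i. B j) = {u. u < n \<and> star u \<inter> E i \<noteq> {}}" if "i \<le> n" for i
  proof (intro equalityI subsetI)
    fix u assume "u \<in> (\<Union>j<i. B j)"
    then obtain j where "j < i" "u \<in> B j" by blast
    then show "u \<in> {u. u < n \<and> star u \<inter> E i \<noteq> {}}"
      using B_iff[of j u] E_mono[of "Suc j" i] that by auto
  next
    fix u assume "u \<in> {u. u < n \<and> star u \<inter> E i \<noteq> {}}"
    then obtain z where z: "u < n" "z \<in> star u" "z \<in> E i" by blast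
    then obtain j where "j < i" "j < n" "xs ! j = z" unfolding E_iff by blast
    then show "u \<in> (\<Union>j<i. B j)" using in_B[of u j] z by blast
  qed
  have self: "u \<in> star u" for u by (simp add: star_def)
  show ?thesis
  proof (rule that[of B])
    show "card (B j) \<le> 2 * w + 1" if "j < n" for j
      using xs that by (simp add: B_def E_def good_order_def)
    show "(\<Union>j<n. B j) = {..<n}"
      using touched[of n] self set_xs xs(1) by (auto simp: E_def)
    show "B i \<inter> B k \<subseteq> B j" if "i \<le> j" "j \<le> k" "k < n" for i j k
    proof -
      \<comment> \<open>Touching \<open>E (Suc j)\<close> is inherited from \<open>i\<close>, not
        being contained in \<open>E j\<close> from \<open>k\<close>.\<close>
      have "E (Suc i) \<subseteq> E (Suc j)" "E j \<subseteq> E k" using that by (simp_all add: E_mono)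
      then show ?thesis using that B_iff[of i] B_iff[of j] B_iff[of k] by auto blast+
    qed
    have edge: "\<exists>j<n. u \<in> B j \<and> z \<in> B j" if "adj u z" "u < z" for u z
    proof -
      obtain j where "j < n" "xs ! j = z" using pos[OF adj_less'[OF \<open>adj u z\<close>]] by blast
      then show ?thesis
        using that in_B[of u j] in_B[of z j] self[of z] adj_less[of u z] adj_less'[of u z]
        by (auto simp: star_def)
    qed
    show "\<exists>j<n. u \<in> B j \<and> z \<in> B j" if "adj u z" for u z
      using edge[of u z] edge[of z u] that adj_sym adj_irrefl by (metis nat_neq_iff)
    show "grown adj (\<Union>j<i. B j)" if "0 < i" "i \<le> n" for i
      using that
    proof (induction i rule: nat_induct_non_zero)
      case 1
      let ?x = "xs ! 0"
      have "E 1 = {?x}" using E_Suc[of 0] 1 by (simp add: E_def)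
      then have "(\<Union>j<1. B j) = {u. u < n \<and> ?x \<in> star u}" using touched[of 1] 1 by auto
      also have "\<dots> = {?x} \<union> {u. u < n \<and> ?x \<in> star u}" using xs_less[of 0] self 1 by auto
      also have "grown adj \<dots>"
        using adj_sym by (intro grown_Un[OF _ grown.singleton]) (auto simp: star_def)
      finally show ?case .
    next
      case (Suc i)
      let ?x = "xs ! i" and ?S = "\<Union>j<i. B j"
      have i: "i < n" using Suc.prems by simp
      have x: "?x < n" using i by (rule xs_less)
      \<comment> \<open>The shared star has its centre \<open>u\<close> in \<open>?S\<close>, and
        \<open>?x\<close> is \<open>u\<close> or a neighbour of it. So \<open>?x\<close> is adjoined
        first, then the other new centres, all adjacent to \<open>?x\<close>.\<close>
      obtain u where u: "?x \<in> star u" "star u \<inter> E i \<noteq> {}"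
        using xs i Suc.hyps unfolding good_order_def E_def by blast
      have "u < n" using u(1) x by (auto simp: star_def dest: adj_less)
      then have "u \<in> ?S" using u(2) touched[of i] i by simp
      then have S: "grown adj (?S \<union> {?x})"
        using u(1) Suc.IH Suc.prems by (intro grown_Un) (auto simp: star_def)
      have "(\<Union>j<Suc i. B j) = (?S \<union> {?x}) \<union> {u. u < n \<and> ?x \<in> star u}"
        using touched[of i] touched[of "Suc i"] i E_Suc[of i] x self[of ?x] by auto
      also have "grown adj \<dots>"
        using adj_sym by (intro grown_Un[OF _ S]) (auto simp: star_def)
      finally show ?case .
    qed
  qed
qed

end

section \<open>From path decompositions to connected path decompositions\<close>

lemma grown_image:
  assumes "grown r S" "\<And>i j. r i j \<Longrightarrow> r' (f i) (f j)"
  shows "grown r' (f ` S)"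
  using assms(1)
proof induction
  case (singleton x)
  then show ?case by (simp add: grown.singleton)
next
  case (insert S s x)
  then show ?case using assms(2) grown.insert[of r' "f ` S" "f s" "f x"] by simp
qed

text \<open>\<open>connected\<close> uses the symmetric closure, so the added arc can be walked both
  ways and all pairs are linked through \<open>s\<close>.\<close>

lemma connected_if_grown:
  assumes "grown (\<lambda>u v. u \<rightarrow>\<^bsub>G\<^esub> v) T"
  shows "connected (G \<restriction> T)"
proof -
  define R where "R T = (arcs_ends (G \<restriction> T))\<^sup>s" for T
  have R_iff: "(u, v) \<in> R T \<longleftrightarrow> u \<in> T \<and> v \<in> T \<and> (u \<rightarrow>\<^bsub>G\<^esub> v \<or> v \<rightarrow>\<^bsub>G\<^esub> u)" for u v T
    by (auto simp: R_def symcl_def arcs_ends_conv induce_subgraph_def)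
  have "T \<noteq> {} \<and> (\<forall>u \<in> T. \<forall>v \<in> T. (u, v) \<in> rtrancl_on T (R T))"
    using assms
  proof induction
    case (singleton x)
    then show ?case by simp
  next
    case (insert S s x)
    let ?T = "insert x S"
    have old: "(u, v) \<in> rtrancl_on ?T (R ?T)" if "u \<in> S" "v \<in> S" for u v
    proof (rule rtrancl_on_mono)
      show "R S \<subseteq> R ?T" by (auto simp: R_iff)
      show "(u, v) \<in> rtrancl_on S (R S)" using insert.IH that by blast
    qed blast
    have "(s, x) \<in> R ?T" "(x, s) \<in> R ?T" using insert.hyps by (auto simp: R_iff)
    then have "(s, x) \<in> rtrancl_on ?T (R ?T)" "(x, s) \<in> rtrancl_on ?T (R ?T)"
      using insert.hyps(2) by (auto intro: rtrancl_on_into_rtrancl_on)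
    then have "(u, s) \<in> rtrancl_on ?T (R ?T) \<and> (s, u) \<in> rtrancl_on ?T (R ?T)" if "u \<in> ?T" for u
      using that old insert.hyps(2) by auto
    then show ?case by (blast intro: rtrancl_on_trans)
  qed
  then show ?thesis by (simp add: connected_conv R_def)
qed

text \<open>By symmetry, connectedness gives directed reachability, under which a set without
  leaving arcs is closed.\<close>

lemma connected_crossing:
  assumes "sym_digraph G" "connected G" "S \<subset> verts G" "S \<noteq> {}"
  shows "\<exists>u\<in>S. \<exists>v\<in>verts G - S. u \<rightarrow>\<^bsub>G\<^esub> v"
proof (rule ccontr)
  assume no: "\<not> ?thesis"
  interpret sym_digraph G by fact
  obtain u v where uv: "u \<in> S" "v \<in> verts G - S" using assms(3,4) by blast
  then have "u \<rightarrow>\<^sup>*\<^bsub>G\<^esub> v"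
    using symmetric_connected_imp_strongly_connected[OF sym_arcs assms(2)] assms(3) by blast
  then have "v \<in> S"
  proof (induction rule: reachable_induct)
    case base
    then show ?case using uv(1) by blast
  next
    case (step x y)
    then show ?case using no adj_in_verts by blast
  qed
  then show False using uv by blast
qed

section \<open>The layout of a path decomposition, and the bags carried back to the graph\<close>

lemma ex_connected_path_decomposition:
  assumes G: "graph G" "connected G" and pd: "path_decomposition G Xs"
    and card_Xs: "\<And>X. X \<in> set Xs \<Longrightarrow> card X \<le> Suc w"
  shows "\<exists>Ys. connected_path_decomposition G Ys \<and> (\<forall>Y \<in> set Ys. card Y \<le> 2 * w + 1)"
proof -
  interpret graph G by (rule G(1))
  define first where "first u = (LEAST i. i < length Xs \<and> u \<in> Xs ! i)" for u
  have "\<exists>i. i < length Xs \<and> u \<in> Xs ! i" if "u \<in> verts G" for u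
    using that pd unfolding path_decomposition_def by (metis UnionE in_set_conv_nth)
  then have first: "first u < length Xs \<and> u \<in> Xs ! first u" if "u \<in> verts G" for u
    using that unfolding first_def by (metis (mono_tags, lifting) LeastI_ex)
  have first_le: "first u \<le> i" if "i < length Xs" "u \<in> Xs ! i" for u i
    using that unfolding first_def by (simp add: Least_le)
  have between: "u \<in> Xs ! j" if "u \<in> Xs ! i" "u \<in> Xs ! k" "i \<le> j" "j \<le> k" "k < length Xs" for u i j k
    using that pd unfolding path_decomposition_def by blast
  obtain l where l: "set l = verts G" "distinct l"
    using finite_distinct_list[OF finite_verts] by blast
  define vs where "vs = sort_key first l"
  define n where "n = length vs"
  have vs: "set vs = verts G" "distinct vs" "sorted (map first vs)"
    using l by (simp_all add: vs_def)
  have first_mono: "first (vs ! i) \<le> first (vs ! j)" if "i \<le> j" "j < n" for i j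
    using sorted_nth_mono[OF vs(3), of i j] that by (simp add: n_def)
  have vs_in: "vs ! i \<in> verts G" if "i < n" for i
    using that vs(1) nth_mem[of i vs] by (simp add: n_def)
  have inj: "inj_on ((!) vs) {..<n}"
    using vs(2) by (auto simp: inj_on_def n_def nth_eq_iff_index_eq)
  have im: "(!) vs ` {..<n} = verts G" using vs(1) by (auto simp: n_def set_conv_nth)
  define A where "A i j \<longleftrightarrow> i < n \<and> j < n \<and> vs ! i \<rightarrow>\<^bsub>G\<^esub> vs ! j" for i j
  \<comment> \<open>The ends of the edge share a bag \<open>k\<close>, and
    \<open>first (vs ! g)\<close> lies between \<open>first (vs ! i)\<close> and
    \<open>k\<close>.\<close>
  have in_bag: "vs ! i \<in> Xs ! first (vs ! g)" if "i \<le> g" "g \<le> j" "A i j" for i j g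
  proof -
    obtain e where "e \<in> arcs G" "tail G e = vs ! i" "head G e = vs ! j"
      using \<open>A i j\<close> by (auto simp: A_def)
    then obtain X where "X \<in> set Xs" "vs ! i \<in> X" "vs ! j \<in> X"
      using pd unfolding path_decomposition_def by metis
    then obtain k where k: "k < length Xs" "vs ! i \<in> Xs ! k" "vs ! j \<in> Xs ! k"
      unfolding in_set_conv_nth by blast
    have "first (vs ! i) \<le> first (vs ! g)" "first (vs ! g) \<le> first (vs ! j)"
      using that by (auto intro: first_mono simp: A_def)
    moreover have "vs ! i \<in> Xs ! first (vs ! i)" using first[OF vs_in] that(3) by (simp add: A_def)
    ultimately show ?thesis
      using between[of "vs ! i" "first (vs ! i)" k "first (vs ! g)"] first_le[OF k(1,3)] k(1,2)
      by linarith
  qed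
  interpret L: vertex_layout n A w
  proof
    show "A j i" if "A i j" for i j
      using that sym_arcs by (auto simp: A_def dest: arcs_ends_symmetric)
    show "\<not> A i i" for i using adj_not_same by (auto simp: A_def)
    show "i < n" if "A i j" for i j using that by (simp add: A_def)
    show "card {i. i < g \<and> (\<exists>j\<ge>g. A i j)} \<le> w" (is "card ?I \<le> w") for g
    proof (cases "g < n")
      case True
      let ?X = "Xs ! first (vs ! g)"
      have X: "?X \<in> set Xs" "vs ! g \<in> ?X" using first[OF vs_in[OF True]] by auto
      have "?X \<subseteq> verts G" using X(1) pd by (auto simp: path_decomposition_def)
      then have fin: "finite ?X" using finite_verts by (rule finite_subset)
      \<comment> \<open>The bag also contains the vertex at \<open>g\<close>, which is not in
        \<open>?I\<close>; this lowers the bound from \<open>Suc w\<close> to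
        \<open>w\<close>.\<close>
      have "insert g ?I \<subseteq> {..<n}" using True by (auto simp: A_def)
      then have inj': "inj_on ((!) vs) (insert g ?I)" by (rule inj_on_subset[OF inj])
      have "(!) vs ` insert g ?I \<subseteq> ?X" using X(2) in_bag[of _ g] by (auto dest: less_imp_le)
      then have "card ((!) vs ` insert g ?I) \<le> card ?X" by (rule card_mono[OF fin])
      then have "card (insert g ?I) \<le> card ?X" by (simp only: card_image[OF inj'])
      then show ?thesis using card_Xs[OF X(1)] by simp
    next
      case False
      then have "?I = {}" by (auto simp: A_def)
      then show ?thesis unfolding \<open>?I = {}\<close> by simp
    qed
    show "\<exists>i\<in>S. \<exists>j\<in>{..<n} - S. A i j" if S: "S \<subset> {..<n}" "S \<noteq> {}" for S
    proof -
      have "(!) vs ` S \<subset> verts G"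
        using image_strict_mono[OF inj S(1)] im by simp
      from connected_crossing[OF sym_digraph_axioms G(2) this]
      obtain u v where uv: "u \<in> (!) vs ` S" "v \<in> verts G - (!) vs ` S" "u \<rightarrow>\<^bsub>G\<^esub> v"
        using S(2) by (metis image_is_empty)
      obtain i where i: "i \<in> S" "u = vs ! i" using uv(1) by blast
      obtain j where j: "j < n" "v = vs ! j" using uv(2) unfolding im[symmetric] by blast
      have "j \<notin> S" using uv(2) j by blast
      then show ?thesis using i j uv(3) S(1) by (auto simp: A_def)
    qed
  qed
  obtain B where B: "\<And>j. j < n \<Longrightarrow> card (B j) \<le> 2 * w + 1"
    "(\<Union>j<n. B j) = {..<n}"
    "\<And>i j. A i j \<Longrightarrow> \<exists>k<n. i \<in> B k \<and> j \<in> B k"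
    "\<And>i j k. i \<le> j \<Longrightarrow> j \<le> k \<Longrightarrow> k < n \<Longrightarrow> B i \<inter> B k \<subseteq> B j"
    "\<And>i. 0 < i \<Longrightarrow> i \<le> n \<Longrightarrow> grown A (\<Union>j<i. B j)"
    by (rule L.ex_bags) (rule that; assumption)
  have B_less: "B j \<subseteq> {..<n}" if "j < n" for j using B(2) that by blast
  define Ys where "Ys = map (\<lambda>j. (!) vs ` B j) [0..<n]"
  have len: "length Ys = n" by (simp add: Ys_def)
  have nth: "Ys ! j = (!) vs ` B j" if "j < n" for j using that by (simp add: Ys_def)
  have set_take: "set (take i Ys) = (\<lambda>j. (!) vs ` B j) ` {..<i}" if "i \<le> n" for i
    using that by (auto simp: Ys_def take_map)
  have prefix: "\<Union>(set (take i Ys)) = (!) vs ` (\<Union>j<i. B j)" if "i \<le> n" for i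
    unfolding set_take[OF that] by blast
  have "n > 0" using G(2) vs(1) by (auto simp: n_def connected_conv)
  have "path_decomposition G Ys"
    unfolding path_decomposition_def
  proof (intro conjI ballI allI impI)
    show "Ys \<noteq> []" using len \<open>n > 0\<close> by auto
    show "\<Union> (set Ys) = verts G"
      using prefix[of n] len B(2) im by simp
    show "\<exists>Y\<in>set Ys. tail G e \<in> Y \<and> head G e \<in> Y" if e: "e \<in> arcs G" for e
    proof -
      obtain i j where ij: "i < n" "vs ! i = tail G e" "j < n" "vs ! j = head G e"
        using e im by (metis imageE lessThan_iff tail_in_verts head_in_verts)
      then have "A i j" using e by (auto simp: A_def arcs_ends_conv)
      then obtain k where "k < n" "i \<in> B k" "j \<in> B k" using B(3) by blast
      then have "tail G e \<in> Ys ! k" "head G e \<in> Ys ! k" "Ys ! k \<in> set Ys"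
        unfolding ij(2)[symmetric] ij(4)[symmetric] using len nth_mem[of k Ys] by (simp_all add: nth)
      then show ?thesis by blast
    qed
    show "Ys ! i \<inter> Ys ! k \<subseteq> Ys ! j" if "i \<le> j \<and> j \<le> k \<and> k < length Ys" for i j k
    proof
      fix y assume y: "y \<in> Ys ! i \<inter> Ys ! k"
      have ijk: "i \<le> j" "j \<le> k" "k < n" using that len by auto
      obtain s t where st: "s \<in> B i" "t \<in> B k" "y = vs ! s" "y = vs ! t"
        using y nth ijk by auto
      have "s < n" "t < n" using st(1,2) B_less[of i] B_less[of k] ijk by auto
      then have "s = t" using st(3,4) by (intro inj_onD[OF inj]) auto
      then have "s \<in> B j" using B(4)[OF ijk] st(1,2) by blast
      then show "y \<in> Ys ! j" using st(3) nth[of j] ijk by simp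
    qed
  qed
  moreover have "connected (G \<restriction> \<Union>(set (take i Ys)))" if "i \<in> {1..length Ys}" for i
  proof -
    have "grown A (\<Union>j<i. B j)" using B(5)[of i] that len by simp
    then have "grown (\<lambda>u v. u \<rightarrow>\<^bsub>G\<^esub> v) ((!) vs ` (\<Union>j<i. B j))"
      by (rule grown_image) (simp add: A_def)
    then show ?thesis using connected_if_grown prefix[of i] that len by simp
  qed
  moreover have "card Y \<le> 2 * w + 1" if "Y \<in> set Ys" for Y
  proof -
    obtain j where j: "j < n" "Y = (!) vs ` B j" using \<open>Y \<in> set Ys\<close> by (auto simp: Ys_def)
    then show ?thesis
      using card_image_le[of "B j" "(!) vs"] B(1)[of j] B_less[of j] finite_subset[of "B j" "{..<n}"] by simp
  qed
  ultimately show ?thesis unfolding connected_path_decomposition_def by blast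
qed

theorem theorem2:
  fixes G :: "('a, 'b) pre_digraph"
  assumes "graph G" and "connected G"
  shows "connected_pathwidth G \<le> 2 * pathwidth G + 1"
proof -
  interpret graph G by fact
  let ?W = "{width Xs | Xs. path_decomposition G Xs}"
  have "pathwidth G \<in> ?W"
    unfolding pathwidth_def using finite_path_decomposition_widths[OF finite_verts]
      path_decomposition_trivial by (intro Min_in) auto
  then obtain Xs where Xs: "path_decomposition G Xs" "pathwidth G = width Xs" by blast
  define m where "m = Max (card ` set Xs)"
  have m: "card X \<le> m" if "X \<in> set Xs" for X using that by (simp add: m_def)
  \<comment> \<open>Keeps the natural subtraction \<open>m - 1\<close> from being truncated.\<close>
  have "m > 0"
  proof -
    obtain u where "u \<in> verts G" using assms(2) by (auto simp: connected_conv)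
    then obtain X where X: "X \<in> set Xs" "u \<in> X"
      using Xs(1) unfolding path_decomposition_def by blast
    then have "finite X"
      using Xs(1) finite_subset[OF _ finite_verts] by (auto simp: path_decomposition_def)
    then have "card X > 0" using X(2) card_gt_0_iff by blast
    then show ?thesis using m[OF X(1)] by simp
  qed
  then obtain Ys where Ys: "connected_path_decomposition G Ys"
    "\<And>Y. Y \<in> set Ys \<Longrightarrow> card Y \<le> 2 * (m - 1) + 1"
    using ex_connected_path_decomposition[OF assms Xs(1), of "m - 1"] m by fastforce
  have "Ys \<noteq> []"
    using Ys(1) by (simp add: connected_path_decomposition_def path_decomposition_def)
  then have "Max (card ` set Ys) \<le> 2 * (m - 1) + 1" using Ys(2) by (intro Max.boundedI) auto
  \<comment> \<open>The bags even give width at most \<open>2 * (m - 1)\<close>, that is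
    \<open>2 * pathwidth G\<close>.\<close>
  then have "width Ys \<le> 2 * pathwidth G + 1"
    using \<open>m > 0\<close> Xs(2) by (simp add: width_def m_def[symmetric] of_nat_diff)
  moreover have "connected_pathwidth G \<le> width Ys"
    unfolding connected_pathwidth_def
    using finite_connected_path_decomposition_widths[OF finite_verts] Ys(1) by (intro Min_le) auto
  ultimately show ?thesis by simp
qed

end
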